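(* Let $\lambda>0$ and $\mu\ge0$ be real with $\mu\ne1$ and $\lambda\ne\mu-1$. Then for every nonnegative integer $n$ and real $x$, $$\mathfrak{V}_{n}(x;\lambda;\mu)=\frac{1}{1-\mu}\left[\left(1-\frac{\mu}{2}\right)\mathfrak{E}_{n}\!\left(x;\frac{\lambda}{1-\mu}\right)-\frac{\mu}{2}\,\mathfrak{B}_{n}\!\left(x;\frac{\lambda}{\mu-1}\right)\right].$$
   Context: For a real parameter $a$, the Apostol-Bernoulli polynomials are defined by $\frac{t}{a e^{t}-1}e^{xt}=\sum_{n\ge0}\mathfrak{B}_n(x;a)\frac{t^n}{n!}$. For real $a\ne-1$, the Apostol-Euler polynomials are defined by $\frac{2}{a e^{t}+1}e^{xt}=\sum_{n\ge0}\mathfrak{E}_n(x;a)\frac{t^n}{n!}$. Both are Taylor expansions at $t=0$. For real $\lambda>0$ and real $\mu\ge0$, $\mu\ne1$, with $\lambda+1-\mu\ne0$, the unified Bernoulli-Euler polynomials of Apostol type are defined by $$\frac{2-\mu+\frac{\mu}{2}t}{\lambda e^{t}+(1-\mu)}e^{xt}=\sum_{n\ge0}\mathfrak{V}_n(x;\lambda;\mu)\frac{t^n}{n!}.$$ *)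

theory Defs
  imports "HOL-Analysis.Analysis"
begin

(* The c with f t = (\<Sum>n. c n * t ^ n / fact n) near 0. The point t = 0 itself is left out, so that
   a removable singularity there (as in t / (exp t - 1)) is disregarded. *)
definition is_egf_coeffs :: "(real \<Rightarrow> real) \<Rightarrow> (nat \<Rightarrow> real) \<Rightarrow> bool" where
  "is_egf_coeffs f c \<longleftrightarrow> (\<forall>\<^sub>F t in at 0. (\<lambda>n. c n * t ^ n / fact n) sums f t)"

definition egf_coeff :: "(real \<Rightarrow> real) \<Rightarrow> nat \<Rightarrow> real" where
  "egf_coeff f = (THE c. is_egf_coeffs f c)"

definition apostol_bernoulli :: "nat \<Rightarrow> real \<Rightarrow> real \<Rightarrow> real" where
  "apostol_bernoulli n x a = egf_coeff (\<lambda>t. t / (a * exp t - 1) * exp (x * t)) n"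

(* meaningful for a \<noteq> -1 only *)
definition apostol_euler :: "nat \<Rightarrow> real \<Rightarrow> real \<Rightarrow> real" where
  "apostol_euler n x a = egf_coeff (\<lambda>t. 2 / (a * exp t + 1) * exp (x * t)) n"

(* meaningful for \<lambda> + 1 - \<mu> \<noteq> 0 only *)
definition unified_bernoulli_euler :: "nat \<Rightarrow> real \<Rightarrow> real \<Rightarrow> real \<Rightarrow> real" where
  "unified_bernoulli_euler n x lam \<mu> =
     egf_coeff (\<lambda>t. (2 - \<mu> + \<mu> / 2 * t) / (lam * exp t + (1 - \<mu>)) * exp (x * t)) n"

(* The remaining facts show that the definite description is proper in all cases of interest. *)

lemma is_egf_coeffs_unique:
  assumes "is_egf_coeffs f c" "is_egf_coeffs f d"
  shows "c = d"
proof -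
  define e where "e n = (c n - d n) / fact n" for n
  have "\<forall>\<^sub>F t in at 0. (\<lambda>n. e n * t ^ n) sums 0"
    using assms unfolding is_egf_coeffs_def
  proof eventually_elim
    case (elim t)
    from sums_diff[OF this] show ?case
      by (simp add: e_def diff_divide_distrib left_diff_distrib)
  qed
  then obtain r where r: "r > 0" "\<And>t. t \<noteq> 0 \<Longrightarrow> \<bar>t\<bar> < r \<Longrightarrow> (\<lambda>n. e n * t ^ n) sums 0"
    unfolding eventually_at by (auto simp: dist_real_def)
  have e0: "e n = 0" for n
  proof (induction n rule: less_induct)
    case (less n)
    have "(\<lambda>m. e (m + n) * t ^ m) sums 0" if t: "t \<noteq> 0" "norm t < r" for t
    proof -
      have "(\<lambda>m. e (m + n) * t ^ (m + n)) sums (0 - (\<Sum>m<n. e m * t ^ m))"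
        using r(2)[of t] t by (subst sums_iff_shift) auto
      hence "(\<lambda>m. e (m + n) * t ^ (m + n)) sums 0"
        using less by simp
      hence "(\<lambda>m. inverse (t ^ n) * (e (m + n) * t ^ (m + n))) sums (inverse (t ^ n) * 0)"
        by (rule sums_mult)
      thus ?thesis using t by (simp add: power_add field_simps)
    qed
    hence "((\<lambda>_. 0) \<longlongrightarrow> e (0 + n)) (at (0 :: real))"
      by (intro powser_limit_0_strong[OF r(1)]) auto
    thus ?case by (simp add: tendsto_const_iff)
  qed
  show ?thesis
    using e0 by (auto simp: e_def fun_eq_iff)
qed

lemma egf_coeff_eqI: "is_egf_coeffs f c \<Longrightarrow> egf_coeff f = c"
  unfolding egf_coeff_def using is_egf_coeffs_unique by blast

lemma has_fps_expansion_imp_is_egf_coeffs: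
  assumes "g has_fps_expansion F" "\<And>t. t \<noteq> 0 \<Longrightarrow> f t = g t"
  shows "is_egf_coeffs f (\<lambda>n. fact n * fps_nth F n)"
proof -
  have ev: "\<forall>\<^sub>F t in nhds 0. eval_fps F t = g t" and rad: "fps_conv_radius F > 0"
    using assms(1) by (auto simp: has_fps_expansion_def)
  have "\<forall>\<^sub>F t in nhds 0. t \<in> eball 0 (fps_conv_radius F)"
    using rad by (intro eventually_nhds_in_open) (auto simp: zero_ereal_def)
  with ev have "\<forall>\<^sub>F t in nhds 0. (\<lambda>n. fps_nth F n * t ^ n) sums g t"
  proof eventually_elim
    case (elim t)
    thus ?case using sums_eval_fps[of t F] by (simp add: in_eball_iff)
  qed
  thus ?thesis
    unfolding is_egf_coeffs_def eventually_at_filter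
    by eventually_elim (simp add: assms(2))
qed

lemma apostol_bernoulli_egf:
  "is_egf_coeffs (\<lambda>t. t / (a * exp t - 1) * exp (x * t)) (\<lambda>n. apostol_bernoulli n x a)"
proof -
  define G where "G = fps_const a * fps_exp 1 - (1 :: real fps)"
  have G1: "fps_nth G 0 = a - 1" "fps_nth G 1 = a" by (simp_all add: G_def)
  have G0: "G \<noteq> 0" using G1 by auto
  have deg: "subdegree G \<le> subdegree (fps_X :: real fps)"
    using G1 by (cases "a = 1") (auto intro!: subdegree_leI)
  have "(\<lambda>t. a * exp (1 * t) - 1) has_fps_expansion G"
    unfolding G_def by (intro fps_expansion_intros)
  from has_fps_expansion_divide[OF has_fps_expansion_fps_X this deg G0 refl]
    have "(\<lambda>t. (if t = 0 then fps_nth fps_X (subdegree G) / fps_nth G (subdegree G)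
            else t / (a * exp (1 * t) - 1)) * exp (x * t)) has_fps_expansion (fps_X / G * fps_exp x)"
    by (intro has_fps_expansion_mult has_fps_expansion_exp)
  hence "is_egf_coeffs (\<lambda>t. t / (a * exp t - 1) * exp (x * t))
           (\<lambda>n. fact n * fps_nth (fps_X / G * fps_exp x) n)"
    by (rule has_fps_expansion_imp_is_egf_coeffs) simp
  thus ?thesis
    using egf_coeff_eqI unfolding apostol_bernoulli_def by auto
qed

lemma apostol_euler_egf:
  assumes "a \<noteq> -1"
  shows "is_egf_coeffs (\<lambda>t. 2 / (a * exp t + 1) * exp (x * t)) (\<lambda>n. apostol_euler n x a)"
proof -
  have "(\<lambda>t. 2 / (a * exp (1 * t) + 1) * exp (x * t)) has_fps_expansion
          (2 / (fps_const a * fps_exp 1 + 1) * fps_exp x)"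
    using assms by (intro fps_expansion_intros) auto
  hence "is_egf_coeffs (\<lambda>t. 2 / (a * exp t + 1) * exp (x * t))
           (\<lambda>n. fact n * fps_nth (2 / (fps_const a * fps_exp 1 + 1) * fps_exp x) n)"
    by (rule has_fps_expansion_imp_is_egf_coeffs) simp
  thus ?thesis
    using egf_coeff_eqI unfolding apostol_euler_def by auto
qed

lemma unified_bernoulli_euler_egf:
  assumes "lam + 1 - \<mu> \<noteq> 0"
  shows "is_egf_coeffs (\<lambda>t. (2 - \<mu> + \<mu> / 2 * t) / (lam * exp t + (1 - \<mu>)) * exp (x * t))
           (\<lambda>n. unified_bernoulli_euler n x lam \<mu>)"
proof -
  let ?F = "(fps_const (2 - \<mu>) + fps_const (\<mu> / 2) * fps_X) /
            (fps_const lam * fps_exp 1 + fps_const (1 - \<mu>)) * fps_exp x"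
  have "(\<lambda>t. (2 - \<mu> + \<mu> / 2 * t) / (lam * exp (1 * t) + (1 - \<mu>)) * exp (x * t))
          has_fps_expansion ?F"
    by (intro has_fps_expansion_mult has_fps_expansion_divide' has_fps_expansion_add
        has_fps_expansion_const has_fps_expansion_fps_X has_fps_expansion_exp) (use assms in simp)
  hence "is_egf_coeffs (\<lambda>t. (2 - \<mu> + \<mu> / 2 * t) / (lam * exp t + (1 - \<mu>)) * exp (x * t))
           (\<lambda>n. fact n * fps_nth ?F n)"
    by (rule has_fps_expansion_imp_is_egf_coeffs) simp
  thus ?thesis
    using egf_coeff_eqI unfolding unified_bernoulli_euler_def by auto
qed

end

theory Submission
  imports Defs
begin

text \<open>Put D = \<lambda> e^t + 1 - \<mu>. After division by 1 - \<mu> or \<mu> - 1, the Euler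
  and Bernoulli denominators become D / (1 - \<mu>) and -D / (1 - \<mu>), so all three generating
  functions share D up to a constant. Splitting the numerator 2 - \<mu> + (\<mu>/2) t gives a
  constant multiple of the Euler function plus one of the Bernoulli function
  (\<open>unified_gf_decomposition\<close>). Expansions combine linearly
  (\<open>is_egf_coeffs_lincomb\<close>) and are unique, so coefficients can be compared.\<close>

lemma is_egf_coeffs_lincomb:
  assumes "is_egf_coeffs f c" "is_egf_coeffs g d"
  shows "is_egf_coeffs (\<lambda>t. a * f t + b * g t) (\<lambda>n. a * c n + b * d n)"
  using assms unfolding is_egf_coeffs_def
proof eventually_elim
  case (elim t)
  from sums_add[OF sums_mult[OF elim(1), of a] sums_mult[OF elim(2), of b]] show ?case
    by (simp add: add_divide_distrib distrib_right mult.assoc)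
qed

(* The singular case D = 0, with D = lam * exp t + (1 - \<mu>), needs no exclusion: then all three
   quotients are 0 by the convention y / 0 = 0. *)
lemma unified_gf_decomposition:
  fixes lam \<mu> x t :: real
  assumes "\<mu> \<noteq> 1"
  shows "(2 - \<mu> + \<mu> / 2 * t) / (lam * exp t + (1 - \<mu>)) * exp (x * t) =
           (1 - \<mu> / 2) / (1 - \<mu>) * (2 / (lam / (1 - \<mu>) * exp t + 1) * exp (x * t))
           + (- (\<mu> / 2) / (1 - \<mu>)) * (t / (lam / (\<mu> - 1) * exp t - 1) * exp (x * t))"
proof -
  define D where "D = lam * exp t + (1 - \<mu>)"
  have nz: "1 - \<mu> \<noteq> 0" "\<mu> - 1 \<noteq> 0"
    using assms by auto
  have E: "lam / (1 - \<mu>) * exp t + 1 = D / (1 - \<mu>)"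
    using nz by (simp add: D_def field_simps)
  have B: "lam / (\<mu> - 1) * exp t - 1 = - (D / (1 - \<mu>))"
    using nz by (simp add: D_def divide_simps) (simp add: algebra_simps)
  show ?thesis
  proof (cases "D = 0")
    case True
    then show ?thesis unfolding E B D_def[symmetric] by simp
  next
    case False
    \<comment> \<open>The factor 1 - \<mu> cancels in both terms; in the second, the two minus signs
      cancel as well.\<close>
    have "(1 - \<mu> / 2) / (1 - \<mu>) * (2 / (D / (1 - \<mu>))) = (2 - \<mu>) / D"
      "- (\<mu> / 2) / (1 - \<mu>) * (t / - (D / (1 - \<mu>))) = \<mu> / 2 * t / D"
      using nz False by (simp_all add: divide_simps)
    then show ?thesis unfolding E B D_def[symmetric]
      by (simp only: mult.assoc[symmetric] distrib_right[symmetric] add_divide_distrib[symmetric])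
  qed
qed

theorem theorem5:
  fixes lam \<mu> x :: real and n :: nat
  assumes "lam > 0" and "\<mu> \<ge> 0" and "\<mu> \<noteq> 1" and "lam \<noteq> \<mu> - 1"
  shows "unified_bernoulli_euler n x lam \<mu> =
           1 / (1 - \<mu>) * ((1 - \<mu> / 2) * apostol_euler n x (lam / (1 - \<mu>))
                          - \<mu> / 2 * apostol_bernoulli n x (lam / (\<mu> - 1)))"
proof -
  \<comment> \<open>Equality would mean \<lambda> = \<mu> - 1, that is, D = 0 at t = 0.\<close>
  have a: "lam / (1 - \<mu>) \<noteq> -1"
    using assms by (auto simp: field_simps)
  have "is_egf_coeffs (\<lambda>t. (2 - \<mu> + \<mu> / 2 * t) / (lam * exp t + (1 - \<mu>)) * exp (x * t))
          (\<lambda>n. (1 - \<mu> / 2) / (1 - \<mu>) * apostol_euler n x (lam / (1 - \<mu>))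
               + (- (\<mu> / 2) / (1 - \<mu>)) * apostol_bernoulli n x (lam / (\<mu> - 1)))"
    unfolding unified_gf_decomposition[OF assms(3)]
    by (rule is_egf_coeffs_lincomb[OF apostol_euler_egf[OF a] apostol_bernoulli_egf])
  \<comment> \<open>Uniqueness of the expansion turns the identity of functions into one of
    coefficients, for all n at once.\<close>
  from egf_coeff_eqI[OF this] have "unified_bernoulli_euler n x lam \<mu> =
      (1 - \<mu> / 2) / (1 - \<mu>) * apostol_euler n x (lam / (1 - \<mu>))
      + (- (\<mu> / 2) / (1 - \<mu>)) * apostol_bernoulli n x (lam / (\<mu> - 1))"
    by (simp add: unified_bernoulli_euler_def)
  then show ?thesis
    by (simp only: right_diff_distrib) simp
qed

end
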